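(* Fix real numbers $0<a_1<a_2$ and $n\ge m>0$, and for $a>0$ let $F_a$ denote the cumulative distribution function of the $\mathrm{Beta}(na,ma)$ distribution. There is a unique $x^*\in(0,1)$ such that for all $x_1,x_2$ with $0<x_1<x^*<x_2<1$ we have $$F_{a_1}(x_1)>F_{a_2}(x_1)\quad\text{and}\quad 1-F_{a_1}(x_2)>1-F_{a_2}(x_2).$$ (That is, $F_{a_2}$ is more bunched around $x^*$ than $F_{a_1}$.)
   Context: The $\mathrm{Beta}(\alpha,\beta)$ distribution ($\alpha,\beta>0$) has density $f_{\alpha,\beta}(x)=x^{\alpha-1}(1-x)^{\beta-1}/B(\alpha,\beta)$ on $(0,1)$, with $B(\alpha,\beta)=\int_0^1 x^{\alpha-1}(1-x)^{\beta-1}\,dx$. For fixed $n,m$, write $p_a(x)=f_{na,ma}(x)$ and $F_a(x)=\int_0^x p_a(t)\,dt$. For c.d.f.'s $F,G$ on $[0,1]$ and $x^*\in(0,1)$, $G$ is more bunched around $x^*$ than $F$ if for all $0<x_1<x^*<x_2<1$ we have $F(x_1)>G(x_1)$ and $1-F(x_2)>1-G(x_2)$. *)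

theory Defs
  imports "HOL-Probability.Probability"
begin

text \<open>
  The constant \<open>Beta\<close> of the library is defined via the Gamma function; the lemma
  \<open>Beta_eq_integral\<close> below identifies it with Euler's integral.
\<close>

definition beta_density :: "real \<Rightarrow> real \<Rightarrow> real \<Rightarrow> real" where
  "beta_density \<alpha> \<beta> x =
     (if 0 < x \<and> x < 1 then x powr (\<alpha> - 1) * (1 - x) powr (\<beta> - 1) / Beta \<alpha> \<beta> else 0)"

definition beta_distribution :: "real \<Rightarrow> real \<Rightarrow> real measure" where
  "beta_distribution \<alpha> \<beta> = density lborel (\<lambda>x. ennreal (beta_density \<alpha> \<beta> x))"

lemma Beta_eq_integral:
  assumes "\<alpha> > 0" "\<beta> > 0"
  shows "Beta \<alpha> \<beta> = integral {0..1} (\<lambda>x::real. x powr (\<alpha> - 1) * (1 - x) powr (\<beta> - 1))"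
  using has_integral_Beta_real[OF assms] by (simp add: integral_unique)

lemma Beta_real_pos:
  assumes "\<alpha> > 0" "\<beta> > (0::real)"
  shows "Beta \<alpha> \<beta> > 0"
  using assms by (auto simp: Beta_def intro!: divide_pos_pos mult_pos_pos Gamma_real_pos)

lemma beta_density_nonneg:
  assumes "\<alpha> > 0" "\<beta> > 0"
  shows "beta_density \<alpha> \<beta> x \<ge> 0"
  using Beta_real_pos[OF assms] by (simp add: beta_density_def)

lemma borel_measurable_beta_density [measurable]: "beta_density \<alpha> \<beta> \<in> borel_measurable borel"
  unfolding beta_density_def[abs_def] by measurable

lemma has_integral_beta_density:
  assumes "\<alpha> > 0" "\<beta> > 0"
  shows "(beta_density \<alpha> \<beta> has_integral 1) {0..1}"
proof -
  have "((\<lambda>x. x powr (\<alpha> - 1) * (1 - x) powr (\<beta> - 1) / Beta \<alpha> \<beta>) has_integral 1) {0..1}"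
    using has_integral_divide[OF has_integral_Beta_real[OF assms], of "Beta \<alpha> \<beta>"]
      Beta_real_pos[OF assms] by simp
  then show ?thesis
    by (rule has_integral_spike[of "{0, 1}", rotated 2]) (auto simp: beta_density_def)
qed

lemma prob_space_beta_distribution:
  assumes "\<alpha> > 0" "\<beta> > 0"
  shows "prob_space (beta_distribution \<alpha> \<beta>)"
proof
  have "emeasure (beta_distribution \<alpha> \<beta>) (space (beta_distribution \<alpha> \<beta>))
        = (\<integral>\<^sup>+x. ennreal (beta_density \<alpha> \<beta> x) \<partial>lborel)"
    by (simp add: beta_distribution_def emeasure_density)
  also have "\<dots> = (\<integral>\<^sup>+x. ennreal (beta_density \<alpha> \<beta> x) * indicator {0..1} x \<partial>lborel)"
    by (intro nn_integral_cong) (auto simp: beta_density_def indicator_def)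
  also have "\<dots> = 1"
    using nn_integral_has_integral_lebesgue'[OF _ has_integral_beta_density[OF assms]]
    by (simp add: beta_density_nonneg assms)
  finally show "emeasure (beta_distribution \<alpha> \<beta>) (space (beta_distribution \<alpha> \<beta>)) = 1" .
qed

lemma cdf_beta_distribution:
  assumes "\<alpha> > 0" "\<beta> > 0" "x \<in> {0..1}"
  shows "cdf (beta_distribution \<alpha> \<beta>) x = integral {0..x} (beta_density \<alpha> \<beta>)"
proof -
  have int: "beta_density \<alpha> \<beta> integrable_on {0..x}"
    using has_integral_beta_density[OF assms(1,2)] assms(3)
    by (auto intro: integrable_on_subinterval has_integral_integrable)
  have nonneg: "integral {0..x} (beta_density \<alpha> \<beta>) \<ge> 0"
    by (intro integral_nonneg int) (simp add: beta_density_nonneg assms)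
  have "emeasure (beta_distribution \<alpha> \<beta>) {..x}
        = (\<integral>\<^sup>+t. ennreal (beta_density \<alpha> \<beta> t) * indicator {..x} t \<partial>lborel)"
    by (simp add: beta_distribution_def emeasure_density)
  also have "\<dots> = (\<integral>\<^sup>+t. ennreal (beta_density \<alpha> \<beta> t) * indicator {0..x} t \<partial>lborel)"
    by (intro nn_integral_cong) (auto simp: beta_density_def indicator_def)
  also have "\<dots> = ennreal (integral {0..x} (beta_density \<alpha> \<beta>))"
    using nn_integral_has_integral_lebesgue'[OF _ integrable_integral[OF int]]
    by (simp add: beta_density_nonneg assms(1,2))
  finally show ?thesis
    using nonneg by (simp add: cdf_def measure_def)
qed

end

theory Submission
  imports Defs
begin

text \<open>
  Write \<open>D = F\<^sub>1 - F\<^sub>2\<close> for the difference of the two distribution functions, where the index 1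
  belongs to the smaller scale parameter. It vanishes at 0 and at 1, and its derivative is the
  difference of the two densities. The quotient of the second density by the first is a constant
  times \<open>x powr p * (1 - x) powr q\<close> with \<open>p = n (a\<^sub>2 - a\<^sub>1) > 0\<close> and \<open>q = m (a\<^sub>2 - a\<^sub>1) > 0\<close>. This
  function has two properties that decide everything.

  It tends to 0 at both ends of the unit interval, so the first density dominates there
  (\<open>beta_density_dominates_near_ends\<close>): \<open>D\<close> is positive just to the right of 0 and negative just
  to the left of 1, hence has an interior zero. And its logarithm has a single critical point, so
  it takes each value at most twice (\<open>powr_product_level_at_most_twice\<close>), and the densities
  agree at most twice (\<open>beta_density_eq_at_most_twice\<close>).
  Two interior zeros of \<open>D\<close> would, together with the zeros 0 and 1, produce three zeros of its
  derivative by Rolle's theorem. Thus \<open>D\<close> has exactly one interior zero \<open>x\<^sup>*\<close>, and is positive to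
  its left and negative to its right (\<open>single_crossing_by_Rolle\<close>). No other point can have this
  property, since the strict signs of \<open>D\<close> would conflict between the two points.
\<close>

section \<open>A single crossing criterion\<close>

text \<open>
  By Rolle's theorem, each zero of \<open>D\<close> strictly inside the interval adds one to the number of
  zeros that its derivative must have; at most two of the latter leave room for only one of the
  former. The intermediate value theorem turns the signs near the ends into signs on the two
  whole subintervals.
\<close>

lemma single_crossing_by_Rolle:
  fixes D D' :: "real \<Rightarrow> real"
  assumes cont: "continuous_on {a..b} D" and "a < b"
    and ends: "D a = 0" "D b = 0"
    and deriv: "\<And>x. a < x \<Longrightarrow> x < b \<Longrightarrow> (D has_real_derivative D' x) (at x)"
    and pos_left: "eventually (\<lambda>x. D' x > 0) (at_right a)"
    and pos_right: "eventually (\<lambda>x. D' x > 0) (at_left b)"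
    and two_zeros: "\<And>x y z. a < x \<Longrightarrow> x < y \<Longrightarrow> y < z \<Longrightarrow> z < b \<Longrightarrow>
                     D' x = 0 \<Longrightarrow> D' y = 0 \<Longrightarrow> D' z = 0 \<Longrightarrow> False"
  obtains c where "a < c" "c < b" "\<And>x. a < x \<Longrightarrow> x < c \<Longrightarrow> D x > 0"
    "\<And>x. c < x \<Longrightarrow> x < b \<Longrightarrow> D x < 0"
proof -
  have cont_sub: "continuous_on {u..v} D" if "a \<le> u" "v \<le> b" for u v
    using cont by (rule continuous_on_subset) (use that in auto)
  have rolle: "\<exists>z>u. z < v \<and> D' z = 0" if "a \<le> u" "u < v" "v \<le> b" "D u = D v" for u v
  proof -
    have "\<exists>z>u. z < v \<and> (\<lambda>h. h * D' z) = (\<lambda>_. 0)"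
    proof (rule Rolle_deriv[OF that(2,4) cont_sub])
      show "(D has_derivative (\<lambda>h. h * D' z)) (at z)" if "u < z" "z < v" for z
        using deriv[of z] that \<open>a \<le> u\<close> \<open>v \<le> b\<close>
        by (simp add: has_field_derivative_def mult.commute[of _ "D' z"])
    qed (use that in auto)
    then show ?thesis
      by (metis mult_1)
  qed
  have unique: "u = v" if "a < u" "u < b" "D u = 0" "a < v" "v < b" "D v = 0" for u v
  proof -
    have no: False if uv: "a < u" "u < v" "v < b" "D u = 0" "D v = 0" for u v
    proof -
      obtain x y z where "a < x" "x < u" "D' x = 0" "u < y" "y < v" "D' y = 0"
        "v < z" "z < b" "D' z = 0"
        using rolle[of a u] rolle[of u v] rolle[of v b] uv ends by auto
      then show False
        using two_zeros[of x y z] by auto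
    qed
    show ?thesis
      using no[of u v] no[of v u] that by (meson linorder_neqE_linordered_idom)
  qed
  have mvt: "\<exists>z>u. z < v \<and> D v - D u = (v - u) * D' z" if uv: "a \<le> u" "u < v" "v \<le> b" for u v
  proof -
    obtain l z where z: "u < z" "z < v" "(D has_real_derivative l) (at z)" "D v - D u = (v - u) * l"
    proof -
      have "D differentiable (at x)" if "u < x" "x < v" for x
        using deriv[of x] that uv by (auto simp: real_differentiable_def)
      then show thesis
        using MVT[OF \<open>u < v\<close> cont_sub[OF uv(1,3)]] that by blast
    qed
    moreover have "l = D' z"
      using z deriv[of z] uv by (intro DERIV_unique[OF z(3)]) auto
    ultimately show ?thesis by blast
  qed
  obtain l where l: "l > a" "\<And>x. a < x \<Longrightarrow> x < l \<Longrightarrow> D' x > 0"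
    using pos_left unfolding eventually_at_right_field by blast
  obtain r where r: "r < b" "\<And>x. r < x \<Longrightarrow> x < b \<Longrightarrow> D' x > 0"
    using pos_right unfolding eventually_at_left_field by blast
  have D_left: "D x > 0" if "a < x" "x < l" "x < b" for x
    using mvt[of a x] l that ends by fastforce
  have D_right: "D x < 0" if xs: "a < x" "r < x" "x < b" for x
  proof -
    obtain z where "x < z" "z < b" "D b - D x = (b - x) * D' z"
      using mvt[of x b] xs by auto
    moreover from this have "(b - x) * D' z > 0"
      using r xs by auto
    ultimately show ?thesis using ends by simp
  qed
  \<comment> \<open>Any positive value of \<open>D\<close> left of a negative one encloses a zero, and the same with the
    signs exchanged; there is only one zero to enclose.\<close>
  have ivt: "\<exists>c. min u v < c \<and> c < max u v \<and> D c = 0"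
    if xs: "a < u" "u < b" "a < v" "v < b" "D u > 0" "D v < 0" for u v
  proof (cases "u < v")
    case True
    then obtain c where "u \<le> c" "c \<le> v" "D c = 0"
      using IVT2'[of D v 0 u] cont_sub[of u v] xs by auto
    then show ?thesis
      using xs True by (intro exI[of _ c]) (auto simp: less_le)
  next
    case False
    then obtain c where "v \<le> c" "c \<le> u" "D c = 0"
      using IVT'[of D v 0 u] cont_sub[of v u] xs by auto
    then show ?thesis
      using xs False by (intro exI[of _ c]) (auto simp: less_le)
  qed
  obtain u0 where u0: "a < u0" "u0 < l" "u0 < b"
    using dense[of a "min l b"] l \<open>a < b\<close> by auto
  obtain v0 where v0: "u0 < v0" "r < v0" "v0 < b"
    using dense[of "max r u0" b] r u0 by auto
  obtain c where c: "u0 < c" "c < v0" "D c = 0"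
    using ivt[of u0 v0] D_left[of u0] D_right[of v0] u0 v0 by auto
  show thesis
  proof
    show "a < c" "c < b" using c u0 v0 by auto
    show "D x > 0" if xs: "a < x" "x < c" for x
    proof (rule ccontr)
      assume "\<not> D x > 0"
      moreover have "D x \<noteq> 0"
        using unique[of x c] xs c v0 u0 by auto
      ultimately obtain e where "min u0 x < e" "e < max u0 x" "D e = 0"
        using ivt[of u0 x] D_left[of u0] xs u0 v0 c by auto
      moreover from this have "a < e" "e < c"
        using xs u0 c by auto
      ultimately show False
        using unique[of e c] u0 v0 c by auto
    qed
    show "D x < 0" if xs: "c < x" "x < b" for x
    proof (rule ccontr)
      assume "\<not> D x < 0"
      moreover have "D x \<noteq> 0"
        using unique[of x c] xs c v0 u0 by auto
      ultimately obtain e where "min x v0 < e" "e < max x v0" "D e = 0"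
        using ivt[of x v0] D_right[of v0] xs u0 v0 c by auto
      moreover from this have "c < e" "e < b"
        using xs v0 c by auto
      ultimately show False
        using unique[of e c] u0 v0 c by auto
    qed
  qed
qed

section \<open>Comparison of two Beta densities\<close>

text \<open>
  The derivative \<open>p / x - q / (1 - x)\<close> of the logarithm vanishes only at \<open>p / (p + q)\<close>, whereas
  three points on one level would give it two zeros.
\<close>

lemma powr_product_level_at_most_twice:
  fixes p q :: real
  assumes "p > 0" "q > 0" and ord: "0 < x" "x < y" "y < z" "z < 1"
    and "x powr p * (1 - x) powr q = k" "y powr p * (1 - y) powr q = k"
      "z powr p * (1 - z) powr q = k"
  shows False
proof -
  define L where "L = (\<lambda>t::real. p * ln t + q * ln (1 - t))"
  have L: "L t = ln (t powr p * (1 - t) powr q)" if "0 < t" "t < 1" for t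
    using that by (simp add: L_def ln_mult ln_powr)
  have eq: "L x = L y" "L y = L z"
    using assms L[of x] L[of y] L[of z] by auto
  have deriv: "(L has_real_derivative p / t - q / (1 - t)) (at t)" if "0 < t" "t < 1" for t
    unfolding L_def using that by (auto intro!: derivative_eq_intros simp: field_simps)
  have rolle: "\<exists>w. u < w \<and> w < v \<and> w = p / (p + q)"
    if uv: "0 < u" "u < v" "v < 1" "L u = L v" for u v
  proof -
    obtain w where w: "u < w" "w < v" "L v - L u = (v - u) * (p / w - q / (1 - w))"
      using MVT2[OF \<open>u < v\<close> deriv] uv by auto
    then have "p / w = q / (1 - w)"
      using uv by simp
    then have "w = p / (p + q)"
      using w uv assms(1,2) by (simp add: field_simps)
    then show ?thesis using w by blast
  qed
  show False
    using rolle[of x y] rolle[of y z] eq ord by force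
qed

text \<open>
  The exponents of the power product are the parameter differences. If both parameters increase,
  they are positive, so the quotient is bounded even if the densities blow up at the ends.
\<close>

lemma beta_density_quotient:
  assumes "0 < x" "x < 1" "\<alpha> > 0" "\<beta> > 0" "\<alpha>' > 0" "\<beta>' > 0"
  shows "beta_density \<alpha>' \<beta>' x =
    beta_density \<alpha> \<beta> x * (x powr (\<alpha>' - \<alpha>) * (1 - x) powr (\<beta>' - \<beta>)) * (Beta \<alpha> \<beta> / Beta \<alpha>' \<beta>')"
proof -
  have "x powr (\<alpha>' - 1) = x powr (\<alpha> - 1) * x powr (\<alpha>' - \<alpha>)"
    "(1 - x) powr (\<beta>' - 1) = (1 - x) powr (\<beta> - 1) * (1 - x) powr (\<beta>' - \<beta>)"
    by (simp_all flip: powr_add)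
  then show ?thesis
    using assms Beta_real_pos[of \<alpha> \<beta>] Beta_real_pos[of \<alpha>' \<beta>']
    by (simp add: beta_density_def field_simps)
qed

lemma beta_density_pos:
  assumes "0 < x" "x < 1" "\<alpha> > 0" "\<beta> > 0"
  shows "beta_density \<alpha> \<beta> x > 0"
  using assms Beta_real_pos[of \<alpha> \<beta>] by (simp add: beta_density_def)

lemma scaled_compare_iff:
  fixes A B B' g :: real
  assumes "A > 0" "B > 0" "B' > 0"
  shows "A * g * (B / B') < A \<longleftrightarrow> g < B' / B" "A * g * (B / B') = A \<longleftrightarrow> g = B' / B"
proof -
  have eq: "A * g * (B / B') = A * (g / (B' / B))"
    using assms by simp
  show "A * g * (B / B') < A \<longleftrightarrow> g < B' / B"
    using mult_less_cancel_left_pos[of A "g / (B' / B)" 1] divide_less_eq_1_pos[of "B' / B" g] assms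
    unfolding eq by (metis divide_pos_pos mult.right_neutral)
  show "A * g * (B / B') = A \<longleftrightarrow> g = B' / B"
    using mult_cancel_left[of A "g / (B' / B)" 1] divide_eq_1_iff[of g "B' / B"] assms
    unfolding eq by (metis divide_pos_pos less_irrefl mult.right_neutral)
qed

lemma beta_density_less_iff:
  assumes "0 < x" "x < 1" "\<alpha> > 0" "\<beta> > 0" "\<alpha>' > 0" "\<beta>' > 0"
  shows "beta_density \<alpha>' \<beta>' x < beta_density \<alpha> \<beta> x \<longleftrightarrow>
    x powr (\<alpha>' - \<alpha>) * (1 - x) powr (\<beta>' - \<beta>) < Beta \<alpha>' \<beta>' / Beta \<alpha> \<beta>"
  unfolding beta_density_quotient[OF assms]
  by (rule scaled_compare_iff(1)) (use assms in \<open>auto intro: beta_density_pos Beta_real_pos\<close>)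

lemma beta_density_eq_iff:
  assumes "0 < x" "x < 1" "\<alpha> > 0" "\<beta> > 0" "\<alpha>' > 0" "\<beta>' > 0"
  shows "beta_density \<alpha>' \<beta>' x = beta_density \<alpha> \<beta> x \<longleftrightarrow>
    x powr (\<alpha>' - \<alpha>) * (1 - x) powr (\<beta>' - \<beta>) = Beta \<alpha>' \<beta>' / Beta \<alpha> \<beta>"
  unfolding beta_density_quotient[OF assms]
  by (rule scaled_compare_iff(2)) (use assms in \<open>auto intro: beta_density_pos Beta_real_pos\<close>)

lemma beta_density_eq_at_most_twice:
  assumes "0 < \<alpha>" "\<alpha> < \<alpha>'" "0 < \<beta>" "\<beta> < \<beta>'" and "0 < x" "x < y" "y < z" "z < 1"
    and "beta_density \<alpha>' \<beta>' x = beta_density \<alpha> \<beta> x" "beta_density \<alpha>' \<beta>' y = beta_density \<alpha> \<beta> y"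
      "beta_density \<alpha>' \<beta>' z = beta_density \<alpha> \<beta> z"
  shows False
  using powr_product_level_at_most_twice[of "\<alpha>' - \<alpha>" "\<beta>' - \<beta>" x y z "Beta \<alpha>' \<beta>' / Beta \<alpha> \<beta>"]
    beta_density_eq_iff[of x \<alpha> \<beta> \<alpha>' \<beta>'] beta_density_eq_iff[of y \<alpha> \<beta> \<alpha>' \<beta>']
    beta_density_eq_iff[of z \<alpha> \<beta> \<alpha>' \<beta>'] assms by auto

text \<open>
  The quotient of the densities extends continuously to the closed interval, with value 0 at both
  ends.
\<close>

lemma beta_density_dominates_near_ends:
  assumes "0 < \<alpha>" "\<alpha> < \<alpha>'" "0 < \<beta>" "\<beta> < \<beta>'"
  shows "eventually (\<lambda>x. beta_density \<alpha>' \<beta>' x < beta_density \<alpha> \<beta> x) (at_right 0)"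
    and "eventually (\<lambda>x. beta_density \<alpha>' \<beta>' x < beta_density \<alpha> \<beta> x) (at_left 1)"
proof -
  define g where "g = (\<lambda>x. x powr (\<alpha>' - \<alpha>) * (1 - x) powr (\<beta>' - \<beta>))"
  have level: "Beta \<alpha>' \<beta>' / Beta \<alpha> \<beta> > 0"
    using assms Beta_real_pos[of \<alpha> \<beta>] Beta_real_pos[of \<alpha>' \<beta>'] by auto
  have cont: "continuous_on {0..1} g"
    unfolding g_def using assms by (intro continuous_intros continuous_on_powr') auto
  have "(g \<longlongrightarrow> g 0) (at_right 0)" "(g \<longlongrightarrow> g 1) (at_left 1)"
    using continuous_on_Icc_at_rightD[OF cont] continuous_on_Icc_at_leftD[OF cont] by auto
  moreover have "g 0 = 0" "g 1 = 0"
    by (auto simp: g_def)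
  ultimately have small: "eventually (\<lambda>x. g x < Beta \<alpha>' \<beta>' / Beta \<alpha> \<beta>) (at_right 0)"
    "eventually (\<lambda>x. g x < Beta \<alpha>' \<beta>' / Beta \<alpha> \<beta>) (at_left 1)"
    using level by (auto intro: order_tendstoD(2))
  have inside: "eventually (\<lambda>x. x \<in> {0<..<1}) (at_right (0::real))"
    "eventually (\<lambda>x. x \<in> {0<..<1}) (at_left (1::real))"
    by (rule eventually_at_right_real eventually_at_left_real; simp)+
  show "eventually (\<lambda>x. beta_density \<alpha>' \<beta>' x < beta_density \<alpha> \<beta> x) (at_right 0)"
    using small(1) inside(1)
    by eventually_elim (use assms in \<open>auto simp: beta_density_less_iff g_def\<close>)
  show "eventually (\<lambda>x. beta_density \<alpha>' \<beta>' x < beta_density \<alpha> \<beta> x) (at_left 1)"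
    using small(2) inside(2)
    by eventually_elim (use assms in \<open>auto simp: beta_density_less_iff g_def\<close>)
qed

section \<open>The distribution functions\<close>

lemma beta_density_integrable:
  assumes "\<alpha> > 0" "\<beta> > 0"
  shows "beta_density \<alpha> \<beta> integrable_on {0..1}"
  using has_integral_beta_density[OF assms] by (rule has_integral_integrable)

lemma cdf_beta_distribution_endpoints:
  assumes "\<alpha> > 0" "\<beta> > 0"
  shows "cdf (beta_distribution \<alpha> \<beta>) 0 = 0" "cdf (beta_distribution \<alpha> \<beta>) 1 = 1"
  using has_integral_beta_density[OF assms]
  by (simp_all add: cdf_beta_distribution assms integral_unique)

lemma continuous_on_cdf_beta_distribution:
  assumes "\<alpha> > 0" "\<beta> > 0"
  shows "continuous_on {0..1} (cdf (beta_distribution \<alpha> \<beta>))"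
proof (rule continuous_on_eq)
  show "continuous_on {0..1} (\<lambda>x. integral {0..x} (beta_density \<alpha> \<beta>))"
    by (rule indefinite_integral_continuous_1[OF beta_density_integrable[OF assms]])
qed (simp add: cdf_beta_distribution assms)

lemma has_real_derivative_cdf_beta_distribution:
  assumes "\<alpha> > 0" "\<beta> > 0" "0 < x" "x < 1"
  shows "(cdf (beta_distribution \<alpha> \<beta>) has_real_derivative beta_density \<alpha> \<beta> x) (at x)"
proof -
  have "continuous_on {0<..<1} (\<lambda>x. x powr (\<alpha> - 1) * (1 - x) powr (\<beta> - 1) / Beta \<alpha> \<beta>)"
    using Beta_real_pos[OF assms(1,2)] by (intro continuous_intros) auto
  then have "continuous_on {0<..<1} (beta_density \<alpha> \<beta>)"
    by (rule continuous_on_eq) (simp add: beta_density_def)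
  then have "continuous (at x within {0..1}) (beta_density \<alpha> \<beta>)"
    using assms by (simp add: continuous_on_eq_continuous_at continuous_at_imp_continuous_at_within)
  then have "((\<lambda>u. integral {0..u} (beta_density \<alpha> \<beta>)) has_vector_derivative beta_density \<alpha> \<beta> x)
      (at x within {0..1})"
    using integral_has_vector_derivative_continuous_at[of "beta_density \<alpha> \<beta>" 0 1 x "{}"]
      beta_density_integrable[OF assms(1,2)] assms by simp
  then have "((\<lambda>u. integral {0..u} (beta_density \<alpha> \<beta>)) has_real_derivative beta_density \<alpha> \<beta> x) (at x)"
    using assms by (simp add: has_real_derivative_iff_has_vector_derivative at_within_Icc_at)
  then show ?thesis
    by (rule has_field_derivative_transform_within_open[of _ _ _ "{0<..<1}"])
      (use assms in \<open>auto simp: cdf_beta_distribution\<close>)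
qed

text \<open>
  Increasing both parameters moves mass from both ends of the interval towards the middle; the
  first distribution function is ahead on the left and behind on the right.
\<close>

lemma cdf_beta_distribution_single_crossing:
  assumes "0 < \<alpha>" "\<alpha> < \<alpha>'" "0 < \<beta>" "\<beta> < \<beta>'"
  obtains c where "0 < c" "c < 1"
    "\<And>x. 0 < x \<Longrightarrow> x < c \<Longrightarrow> cdf (beta_distribution \<alpha>' \<beta>') x < cdf (beta_distribution \<alpha> \<beta>) x"
    "\<And>x. c < x \<Longrightarrow> x < 1 \<Longrightarrow> cdf (beta_distribution \<alpha> \<beta>) x < cdf (beta_distribution \<alpha>' \<beta>') x"
proof -
  let ?D = "\<lambda>x. cdf (beta_distribution \<alpha> \<beta>) x - cdf (beta_distribution \<alpha>' \<beta>') x"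
  let ?D' = "\<lambda>x. beta_density \<alpha> \<beta> x - beta_density \<alpha>' \<beta>' x"
  have pos: "\<alpha> > 0" "\<beta> > 0" "\<alpha>' > 0" "\<beta>' > 0"
    using assms by auto
  show thesis
  proof (rule single_crossing_by_Rolle[of 0 1 ?D ?D'])
    show "continuous_on {0..1} ?D"
      using pos by (intro continuous_intros continuous_on_cdf_beta_distribution)
    show "?D 0 = 0" "?D 1 = 0"
      using pos by (simp_all add: cdf_beta_distribution_endpoints)
    show "(?D has_real_derivative ?D' x) (at x)" if "0 < x" "x < 1" for x
      using pos that by (intro DERIV_diff has_real_derivative_cdf_beta_distribution)
    show "eventually (\<lambda>x. ?D' x > 0) (at_right 0)" "eventually (\<lambda>x. ?D' x > 0) (at_left 1)"
      using beta_density_dominates_near_ends[OF assms] by simp_all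
    show False if "0 < x" "x < y" "y < z" "z < 1" "?D' x = 0" "?D' y = 0" "?D' z = 0" for x y z
      using beta_density_eq_at_most_twice[OF assms that(1-4)] that by simp
  qed (auto intro: that)
qed

theorem theorem4p3:
  fixes a\<^sub>1 a\<^sub>2 n m :: real and F :: "real \<Rightarrow> real \<Rightarrow> real"
  defines "F \<equiv> (\<lambda>a. cdf (beta_distribution (n * a) (m * a)))"
  assumes "0 < a\<^sub>1" and "a\<^sub>1 < a\<^sub>2" and "m > 0" and "n \<ge> m"
  shows "\<exists>!xstar. 0 < xstar \<and> xstar < 1 \<and>
           (\<forall>x\<^sub>1 x\<^sub>2. 0 < x\<^sub>1 \<and> x\<^sub>1 < xstar \<and> xstar < x\<^sub>2 \<and> x\<^sub>2 < 1 \<longrightarrow>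
              F a\<^sub>1 x\<^sub>1 > F a\<^sub>2 x\<^sub>1 \<and> 1 - F a\<^sub>1 x\<^sub>2 > 1 - F a\<^sub>2 x\<^sub>2)"
    (is "\<exists>!c. ?bunched c")
proof -
  have "0 < n * a\<^sub>1" "n * a\<^sub>1 < n * a\<^sub>2" "0 < m * a\<^sub>1" "m * a\<^sub>1 < m * a\<^sub>2"
    using assms by auto
  then obtain c where c: "0 < c" "c < 1" "\<And>x. 0 < x \<Longrightarrow> x < c \<Longrightarrow> F a\<^sub>2 x < F a\<^sub>1 x"
    "\<And>x. c < x \<Longrightarrow> x < 1 \<Longrightarrow> F a\<^sub>1 x < F a\<^sub>2 x"
    unfolding F_def by (rule cdf_beta_distribution_single_crossing) blast
  then have bunched: "?bunched c"
    by auto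
  \<comment> \<open>Strictly between two such points the difference would have both signs. The condition speaks
    of pairs, so each sign is read off together with some point on the other side.\<close>
  have no: False if d: "?bunched d" "?bunched e" "d < e" for d e
  proof -
    obtain x where x: "d < x" "x < e"
      using dense[OF \<open>d < e\<close>] by auto
    obtain u v where uv: "0 < u" "u < d" "e < v" "v < 1"
      using dense[of 0 d] dense[of e 1] d by auto
    then have "0 < x" "x < 1"
      using x by auto
    then have "1 - F a\<^sub>1 x > 1 - F a\<^sub>2 x" "F a\<^sub>1 x > F a\<^sub>2 x"
      using d(1)[THEN conjunct2, THEN conjunct2, rule_format, of u x, THEN conjunct2]
        d(2)[THEN conjunct2, THEN conjunct2, rule_format, of x v, THEN conjunct1] x uv
      by simp_all
    then show False by simp
  qed
  show ?thesis
  proof (rule ex1I)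
    show "?bunched c" by (rule bunched)
    show "e = c" if "?bunched e" for e
      using no[OF that bunched] no[OF bunched that] by (meson linorder_neqE_linordered_idom)
  qed
qed

end
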